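(* Let $X$ be a real Hilbert space and let $C\subset X$ be an unbounded closed convex subset satisfying at least one of the following conditions: (A) $\operatorname{int}\operatorname{bar}(C)\neq\emptyset$; (C) there exist $r>0$ and a finite-dimensional subspace $Z$ of $X$ such that $C\subset B(0;r)+Z$. Then $C$ has the strong separation property if and only if $\operatorname{int}C$ is nonempty and $\operatorname{bar}(C)=\operatorname{int}\operatorname{bar}(C)\cup\{0\}$.
   Context: The barrier cone of $C$ is $\operatorname{bar}(C)=\{x^*\in X^*: \sup_{c\in C}\langle x^*,c\rangle<+\infty\}$; $\operatorname{int}$ denotes interior in the norm topology (of $X$ or $X^*$). $B(0;r)$ is the open ball of radius $r$ around $0$. Convex sets $C,D\subset X$ are strongly separated if there exists $x^*\in X^*\setminus\{0\}$ with $\sup_{c\in C}\langle x^*,c\rangle<\inf_{d\in D}\langle x^*,d\rangle$. A convex set $C$ has the strong separation property if it is strongly separated from every nonempty closed convex subset $D$ of $X$ disjoint from $C$. *)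

theory Defs
  imports "HOL-Analysis.Analysis" "HOL-Library.Set_Algebras"
begin

text \<open>
  The dual space is the type \<open>'a \<Rightarrow>\<^sub>L real\<close> of bounded linear functionals with the operator norm,
  so \<open>interior\<close> of a barrier cone refers to the norm topology of the dual.  Suprema and
  infima are taken in the extended reals, so that they always exist.
\<close>

definition barrier_cone :: "'a::real_normed_vector set \<Rightarrow> ('a \<Rightarrow>\<^sub>L real) set" where
  "barrier_cone C = {f. (SUP c\<in>C. ereal (blinfun_apply f c)) < \<infinity>}"

definition strongly_separated :: "'a::real_normed_vector set \<Rightarrow> 'a set \<Rightarrow> bool" where
  "strongly_separated C D \<longleftrightarrow>
     (\<exists>f::'a \<Rightarrow>\<^sub>L real. f \<noteq> 0 \<and>
        (SUP c\<in>C. ereal (blinfun_apply f c)) < (INF d\<in>D. ereal (blinfun_apply f d)))"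

definition strong_separation_property :: "'a::real_normed_vector set \<Rightarrow> bool" where
  "strong_separation_property C \<longleftrightarrow>
     (\<forall>D. D \<noteq> {} \<and> closed D \<and> convex D \<and> C \<inter> D = {} \<longrightarrow> strongly_separated C D)"

definition finite_dim_subspace :: "'a::real_vector set \<Rightarrow> bool" where
  "finite_dim_subspace Z \<longleftrightarrow> subspace Z \<and> (\<exists>B. finite B \<and> Z = span B)"

end

theory Submission
  imports Defs
begin

text \<open>
  A nonzero \<open>f\<close> in the barrier cone of \<open>C\<close> is an interior point of that cone iff its slices
  \<open>{c \<in> C. \<alpha> \<le> f c}\<close> are bounded. An unbounded slice gives, by uniform boundedness, a
  functional \<open>g\<close> unbounded on it, and the hyperbolic region
  \<open>{z. g z > 0 \<and> (f z - sup f C) * g z \<ge> 1}\<close> is then disjoint from \<open>C\<close> but at distance \<open>0\<close>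
  from it. So strong separation forces the condition on the barrier cone. If the barrier cone
  is \<open>{0}\<close>, then \<open>C\<close> is the whole space; otherwise bounded slices give \<open>C\<close> a recession
  direction \<open>v\<close>. If \<open>C\<close> had empty interior, some line parallel to \<open>v\<close> would miss \<open>C\<close> by Baire's
  theorem, and no functional in the interior of the barrier cone is constant along \<open>v\<close>.
  Conversely, a functional weakly separating \<open>C\<close> from a disjoint closed convex \<open>D\<close> has bounded
  slices; if the distance of \<open>C\<close> and \<open>D\<close> were \<open>0\<close>, the points of a slice within \<open>1/n\<close> of \<open>D\<close>
  would form nested nonempty bounded closed convex sets, whose common point lies in \<open>C \<inter> D\<close>.
\<close>

section \<open>Barrier cones and strong separation expressed by real bounds\<close>

lemma barrier_cone_iff:
  "f \<in> barrier_cone C \<longleftrightarrow> (\<exists>B. \<forall>c\<in>C. blinfun_apply f c \<le> B)"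
proof
  assume "f \<in> barrier_cone C"
  then have "(SUP c\<in>C. ereal (blinfun_apply f c)) < \<infinity>"
    by (simp add: barrier_cone_def)
  then obtain B where B: "(SUP c\<in>C. ereal (blinfun_apply f c)) < ereal B"
    using ereal_dense2 by blast
  have "blinfun_apply f c \<le> B" if "c \<in> C" for c
    using B SUP_upper[OF that, of "\<lambda>c. ereal (blinfun_apply f c)"]
    by (metis ereal_less_eq(3) less_imp_le order_trans)
  then show "\<exists>B. \<forall>c\<in>C. blinfun_apply f c \<le> B" by blast
next
  assume "\<exists>B. \<forall>c\<in>C. blinfun_apply f c \<le> B"
  then obtain B where "\<forall>c\<in>C. blinfun_apply f c \<le> B" by blast
  then have "(SUP c\<in>C. ereal (blinfun_apply f c)) \<le> ereal B"
    by (intro SUP_least) simp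
  also have "\<dots> < \<infinity>" by simp
  finally show "f \<in> barrier_cone C" by (simp add: barrier_cone_def)
qed

text \<open>Density of the reals, used twice, fits \<open>a < b\<close> into the strict gap between
  supremum and infimum. Later arguments then involve real bounds only.\<close>

lemma strongly_separated_iff:
  "strongly_separated C D \<longleftrightarrow>
     (\<exists>f a (b::real). f \<noteq> 0 \<and> a < b \<and> (\<forall>c\<in>C. blinfun_apply f c \<le> a) \<and> (\<forall>d\<in>D. b \<le> blinfun_apply f d))"
proof
  assume "strongly_separated C D"
  then obtain f where f: "f \<noteq> 0"
    and lt: "(SUP c\<in>C. ereal (blinfun_apply f c)) < (INF d\<in>D. ereal (blinfun_apply f d))"
    by (auto simp: strongly_separated_def)
  obtain a where a: "(SUP c\<in>C. ereal (blinfun_apply f c)) < ereal a"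
    "ereal a < (INF d\<in>D. ereal (blinfun_apply f d))"
    using ereal_dense2[OF lt] by blast
  obtain b where b: "ereal a < ereal b" "ereal b < (INF d\<in>D. ereal (blinfun_apply f d))"
    using ereal_dense2[OF a(2)] by blast
  have "blinfun_apply f c \<le> a" if "c \<in> C" for c
    using a(1) SUP_upper[OF that, of "\<lambda>c. ereal (blinfun_apply f c)"]
    by (metis ereal_less_eq(3) less_imp_le order_trans)
  moreover have "b \<le> blinfun_apply f d" if "d \<in> D" for d
    using b(2) INF_lower[OF that, of "\<lambda>d. ereal (blinfun_apply f d)"]
    by (metis ereal_less_eq(3) less_imp_le order_trans)
  ultimately show "\<exists>f a (b::real). f \<noteq> 0 \<and> a < b \<and> (\<forall>c\<in>C. blinfun_apply f c \<le> a) \<and> (\<forall>d\<in>D. b \<le> blinfun_apply f d)"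
    using f b(1) unfolding less_ereal.simps(1) by blast
next
  assume "\<exists>f a (b::real). f \<noteq> 0 \<and> a < b \<and> (\<forall>c\<in>C. blinfun_apply f c \<le> a) \<and> (\<forall>d\<in>D. b \<le> blinfun_apply f d)"
  then obtain f and a b :: real where f: "f \<noteq> 0" "a < b" "\<forall>c\<in>C. blinfun_apply f c \<le> a"
    "\<forall>d\<in>D. b \<le> blinfun_apply f d" by blast
  have "(SUP c\<in>C. ereal (blinfun_apply f c)) \<le> ereal a"
    using f by (intro SUP_least) simp
  also have "\<dots> < ereal b" using f by simp
  also have "\<dots> \<le> (INF d\<in>D. ereal (blinfun_apply f d))"
    using f by (intro INF_greatest) simp
  finally show "strongly_separated C D" using f by (auto simp: strongly_separated_def)
qed

lemma zero_in_barrier_cone: "0 \<in> barrier_cone C"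
  by (auto simp: barrier_cone_iff)

lemma blinfun_inner_right_eq_0_iff [simp]: "blinfun_inner_right y = 0 \<longleftrightarrow> y = 0"
  by (metis blinfun.zero_left blinfun.zero_right blinfun_inner_right.rep_eq inner_eq_zero_iff
      bounded_linear.linear bounded_linear_blinfun_inner_right linear_0)

section \<open>Consequences of completeness: Baire category and nested convex sets\<close>

lemma Baire_closed_Union:
  fixes F :: "nat \<Rightarrow> 'a::complete_space set"
  assumes "\<And>n. closed (F n)" "(\<Union>n. F n) = UNIV"
  shows "\<exists>n. interior (F n) \<noteq> {}"
proof (rule ccontr)
  assume "\<nexists>n. interior (F n) \<noteq> {}"
  then have "euclidean interior_of \<Union>(range F) = {}"
    using assms
    by (intro Baire_category_alt) (auto simp: completely_metrizable_space_euclidean)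
  with assms show False by simp
qed

text \<open>This replaces weak compactness of bounded closed convex sets: nearly norm-minimal
  points of the sets form a Cauchy sequence by the parallelogram law.\<close>

lemma nested_closed_convex_Inter_nonempty:
  fixes A :: "nat \<Rightarrow> 'a::{real_inner, complete_space} set"
  assumes closed: "\<And>n. closed (A n)" and convex: "\<And>n. convex (A n)"
    and nonempty: "\<And>n. A n \<noteq> {}" and dec: "\<And>m n. m \<le> n \<Longrightarrow> A n \<subseteq> A m"
    and bdd: "bounded (A 0)"
  shows "(\<Inter>n. A n) \<noteq> {}"
proof -
  \<comment> \<open>\<open>q n\<close> is the squared distance from the origin to
    \<open>A n\<close>. It grows with \<open>n\<close> and stays bounded because \<open>A n\<close>
    lies in \<open>A 0\<close>, hence it converges.\<close>
  define q where "q n = Inf ((\<lambda>x. x \<bullet> x) ` A n)" for n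
  have bb: "bdd_below ((\<lambda>x. x \<bullet> x) ` A n)" for n
    by (rule bdd_belowI[of _ 0]) auto
  have q_le: "q n \<le> x \<bullet> x" if "x \<in> A n" for n x
    unfolding q_def by (rule cInf_lower) (use that bb in auto)
  have q_mono: "q m \<le> q n" if "m \<le> n" for m n
    unfolding q_def by (rule cInf_superset_mono) (use nonempty dec[OF that] bb in auto)
  obtain K where K: "\<And>x. x \<in> A 0 \<Longrightarrow> norm x \<le> K"
    using bdd by (auto simp: bounded_iff)
  have q_bdd: "q n \<le> K\<^sup>2" for n
  proof -
    obtain x where x: "x \<in> A n" using nonempty by blast
    then have "norm x \<le> K" using K dec[of 0 n] by auto
    then have "x \<bullet> x \<le> K\<^sup>2" by (simp add: power_mono dot_square_norm)
    with q_le[OF x] show ?thesis by linarith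
  qed
  have "\<exists>x\<in>A n. x \<bullet> x < q n + inverse (real (Suc n))" for n
  proof -
    have "Inf ((\<lambda>x. x \<bullet> x) ` A n) < q n + inverse (real (Suc n))"
      by (simp add: q_def)
    then show ?thesis using cInf_lessD[of "(\<lambda>x. x \<bullet> x) ` A n"] nonempty by blast
  qed
  then obtain x where xA: "\<And>n. x n \<in> A n"
    and xq: "\<And>n. x n \<bullet> x n < q n + inverse (real (Suc n))" by metis
  \<comment> \<open>Parallelogram law: for \<open>n \<le> m\<close> the midpoint of
    \<open>x n\<close> and \<open>x m\<close> lies in \<open>A n\<close>, so its squared norm is at
    least \<open>q n\<close>.\<close>
  have dist_le: "(dist (x n) (x m))\<^sup>2 \<le> 2 * (q m - q n) + 4 * inverse (real (Suc n))"
    if "n \<le> m" for m n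
  proof -
    have "x m \<in> A n" using xA dec[OF that] by auto
    then have "(1/2) *\<^sub>R x n + (1/2) *\<^sub>R x m \<in> A n"
      using convexD[OF convex xA[of n], of "x m" "1/2" "1/2"] by simp
    from q_le[OF this] have "4 * q n \<le> x n \<bullet> x n + 2 * (x n \<bullet> x m) + x m \<bullet> x m"
      by (simp add: inner_simps inner_commute field_simps)
    moreover have "(dist (x n) (x m))\<^sup>2 = x n \<bullet> x n - 2 * (x n \<bullet> x m) + x m \<bullet> x m"
      by (simp add: dist_norm dot_square_norm[symmetric] inner_simps inner_commute)
    moreover have "inverse (real (Suc m)) \<le> inverse (real (Suc n))"
      using that by (simp add: field_simps)
    ultimately show ?thesis using xq[of n] xq[of m] by argo
  qed
  have "convergent q"
    by (rule incseq_convergent[of q "K\<^sup>2"]) (use q_mono q_bdd in \<open>auto simp: incseq_def convergent_def\<close>)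
  then have Cq: "Cauchy q" by (rule convergent_Cauchy)
  have "Cauchy x"
    unfolding Cauchy_altdef
  proof (intro allI impI)
    fix e :: real assume e: "e > 0"
    \<comment> \<open>With both error terms below \<open>e\<^sup>2 / 8\<close>, the bound
      \<open>dist_le\<close> gives less than \<open>(2 + 4) / 8\<close> of
      \<open>e\<^sup>2\<close>.\<close>
    obtain M where M: "\<And>m n. m \<ge> M \<Longrightarrow> n \<ge> M \<Longrightarrow> dist (q m) (q n) < e\<^sup>2 / 8"
      using metric_CauchyD[OF Cq, of "e\<^sup>2/8"] e by auto
    obtain N where N: "inverse (real (Suc N)) < e\<^sup>2 / 8"
      using reals_Archimedean[of "e\<^sup>2/8"] e by auto
    have "dist (x n) (x m) < e" if "n \<ge> max M N" "m > n" for m n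
    proof -
      have "inverse (real (Suc n)) \<le> inverse (real (Suc N))"
        using that by (simp add: field_simps)
      then have "inverse (real (Suc n)) < e\<^sup>2 / 8" using N by (rule le_less_trans)
      moreover have "q m - q n < e\<^sup>2 / 8"
        using M[of m n] that unfolding dist_real_def by linarith
      ultimately have "2 * (q m - q n) + 4 * inverse (real (Suc n))
          < 2 * (e\<^sup>2 / 8) + 4 * (e\<^sup>2 / 8)"
        by (intro add_strict_mono mult_strict_left_mono) auto
      also have "\<dots> \<le> e\<^sup>2" by simp
      finally have "(dist (x n) (x m))\<^sup>2 < e\<^sup>2"
        using dist_le[of n m] that by (simp del: of_nat_Suc)
      then show ?thesis using e by (meson less_imp_le power_less_imp_less_base)
    qed
    then show "\<exists>M. \<forall>m\<ge>M. \<forall>n>m. dist (x m) (x n) < e" by blast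
  qed
  then obtain l where l: "x \<longlonglongrightarrow> l" using Cauchy_convergent convergent_def by blast
  have "l \<in> A n" for n
  proof (rule Lim_in_closed_set[OF closed _ _ l])
    show "\<forall>\<^sub>F k in sequentially. x k \<in> A n"
      unfolding eventually_sequentially using xA dec by blast
  qed simp
  then show ?thesis by blast
qed

section \<open>Separation from the origin and uniform boundedness\<close>

text \<open>The witness \<open>y\<close> is the point of \<open>E\<close> nearest to the origin,
  obtained as a common point of the intersections of \<open>E\<close> with balls whose radii
  decrease to \<open>d\<close>. If \<open>y \<bullet> x < y \<bullet> y\<close> for some
  \<open>x\<close> in \<open>E\<close>, a small move from \<open>y\<close> towards \<open>x\<close>
  would come closer to the origin.\<close>

lemma strict_separation_from_0:
  fixes E :: "'a::{real_inner, complete_space} set"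
  assumes E: "closed E" "convex E" and ne: "E \<noteq> {}" and "0 \<notin> E"
  shows "\<exists>y. y \<noteq> 0 \<and> (\<forall>x\<in>E. y \<bullet> y \<le> y \<bullet> x)"
proof -
  define d where "d = infdist 0 E"
  define A where "A n = E \<inter> cball 0 (d + inverse (real (Suc n)))" for n
  have "(\<Inter>n. A n) \<noteq> {}"
  proof (rule nested_closed_convex_Inter_nonempty)
    show "closed (A n)" "convex (A n)" for n
      using E by (auto simp: A_def intro!: convex_Int)
    show "A n \<noteq> {}" for n
    proof -
      have "infdist 0 E < d + inverse (real (Suc n))" by (simp add: d_def)
      then have "\<exists>a\<in>E. dist 0 a < d + inverse (real (Suc n))"
        using ne cInf_lessD[of "dist 0 ` E"] by (auto simp: infdist_notempty)
      then show ?thesis by (auto simp: A_def intro: less_imp_le)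
    qed
    show "A n \<subseteq> A m" if "m \<le> n" for m n
    proof -
      have "inverse (real (Suc n)) \<le> inverse (real (Suc m))"
        using that by (simp add: field_simps)
      then show ?thesis unfolding A_def by (intro Int_mono order_refl subset_cball add_left_mono)
    qed
    show "bounded (A 0)" by (auto simp: A_def)
  qed
  then obtain y where y: "\<And>n. y \<in> A n" by blast
  have yE: "y \<in> E" using y by (auto simp: A_def)
  have "norm y \<le> d"
  proof (rule field_le_epsilon)
    fix e :: real assume "e > 0"
    then obtain n where "inverse (real (Suc n)) < e" using reals_Archimedean by blast
    then show "norm y \<le> d + e" using y[of n] by (simp add: A_def)
  qed
  then have min: "norm y \<le> norm x" if "x \<in> E" for x
    using infdist_le[OF that, of 0] by (simp add: d_def)
  have "y \<bullet> y \<le> y \<bullet> x" if x: "x \<in> E" for x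
  proof (rule ccontr)
    assume "\<not> ?thesis"
    then have "inner (0 - y) (x - y) > 0" by (simp add: inner_simps)
    from closer_point_lemma[OF this] obtain u
      where u: "u > 0" "u \<le> 1" "dist (y + u *\<^sub>R (x - y)) 0 < dist y 0"
      by (auto simp: dist_commute)
    have "y + u *\<^sub>R (x - y) \<in> E"
      using convexD_alt[OF E(2) yE x, of u] u by (simp add: algebra_simps)
    with min u(3) show False by fastforce
  qed
  moreover have "y \<noteq> 0" using yE \<open>0 \<notin> E\<close> by auto
  ultimately show ?thesis by blast
qed

text \<open>Uniform boundedness from upper bounds alone: Baire's theorem yields a ball around some
  \<open>a\<close> whose members share the bound \<open>n\<close> on \<open>S\<close>, and moving
  from \<open>a\<close> by \<open>e\<close> in the direction of \<open>c\<close> isolates the term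
  \<open>e * norm c\<close>.\<close>

lemma pointwise_bounded_imp_bounded:
  fixes S :: "'a::{real_inner, complete_space} set"
  assumes "\<And>y. \<exists>B. \<forall>c\<in>S. y \<bullet> c \<le> B"
  shows "bounded S"
proof -
  define F where "F n = {y. \<forall>c\<in>S. y \<bullet> c \<le> real n}" for n
  have "F n = (\<Inter>c\<in>S. {y. y \<bullet> c \<le> real n})" for n
    by (auto simp: F_def)
  then have "closed (F n)" for n
    by (auto intro!: closed_INT closed_Collect_le continuous_intros)
  moreover have "(\<Union>n. F n) = UNIV"
  proof -
    have "\<exists>n. y \<in> F n" for y
    proof -
      obtain B where B: "\<forall>c\<in>S. y \<bullet> c \<le> B" using assms by blast
      obtain n where "B \<le> real n" using real_arch_simple by blast
      with B show ?thesis by (auto simp: F_def intro: order_trans)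
    qed
    then show ?thesis by auto
  qed
  ultimately obtain n where "interior (F n) \<noteq> {}"
    using Baire_closed_Union by blast
  then obtain a e where e: "e > 0" "cball a e \<subseteq> F n"
    using mem_interior_cball by blast
  \<comment> \<open>The ball is centred at \<open>a\<close> rather than at the origin, so a lower
    bound for \<open>a \<bullet> c\<close> is required too; it is the hypothesis at
    \<open>- a\<close>.\<close>
  obtain B where B: "\<forall>c\<in>S. (- a) \<bullet> c \<le> B" using assms by blast
  have "norm c \<le> (real n + B) / e" if c: "c \<in> S" for c
  proof (cases "c = 0")
    case True
    have "a \<in> F n" using e by auto
    with True c B have "0 \<le> real n" "0 \<le> B" by auto
    with True e show ?thesis by simp
  next
    case False
    have "a + (e / norm c) *\<^sub>R c \<in> F n"
      using e False by (intro subsetD[OF e(2)]) (simp add: dist_norm)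
    then have "a \<bullet> c + (e / norm c) * (c \<bullet> c) \<le> real n"
      using c by (auto simp: F_def inner_simps)
    moreover have "(e / norm c) * (c \<bullet> c) = e * norm c"
      using False by (simp add: dot_square_norm power2_eq_square)
    ultimately have "e * norm c \<le> real n + B" using B c by fastforce
    then show ?thesis using e by (simp add: field_simps)
  qed
  then show ?thesis by (auto simp: bounded_iff)
qed

section \<open>Interior points of the barrier cone and bounded slices\<close>

text \<open>A small multiple of any \<open>y\<close> can be added to \<open>f\<close> without
  leaving the barrier cone. As \<open>f\<close> is bounded below on the slice, \<open>y\<close> is
  bounded above there, and uniform boundedness applies.\<close>

lemma bounded_slice:
  fixes C :: "'a::{real_inner, complete_space} set"
  assumes "f \<in> interior (barrier_cone C)"
  shows "bounded {c \<in> C. \<alpha> \<le> blinfun_apply f c}"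
proof (rule pointwise_bounded_imp_bounded)
  fix y :: 'a
  obtain e where e: "e > 0" "cball f e \<subseteq> barrier_cone C"
    using assms mem_interior_cball by blast
  \<comment> \<open>The perturbation \<open>s *\<^sub>R blinfun_inner_right y\<close> has norm at
    most \<open>e\<close>; the \<open>+ 1\<close> keeps the denominator positive when
    \<open>y = 0\<close>.\<close>
  define s where "s = e / (norm (blinfun_inner_right y) + 1)"
  have n: "norm (blinfun_inner_right y) + 1 > 0" by (simp add: add_nonneg_pos)
  have s: "s > 0" using e n by (simp add: s_def)
  have "s * norm (blinfun_inner_right y) \<le> s * (norm (blinfun_inner_right y) + 1)"
    using s by simp
  also have "\<dots> = e" using n by (simp add: s_def)
  finally have "f + s *\<^sub>R blinfun_inner_right y \<in> barrier_cone C"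
    using s by (intro subsetD[OF e(2)]) (simp add: dist_norm)
  then obtain B where B: "\<forall>c\<in>C. blinfun_apply f c + s * (y \<bullet> c) \<le> B"
    by (auto simp: barrier_cone_iff blinfun.bilinear_simps)
  have "y \<bullet> c \<le> (B - \<alpha>) / s" if "c \<in> {c \<in> C. \<alpha> \<le> blinfun_apply f c}" for c
  proof -
    have "s * (y \<bullet> c) \<le> B - \<alpha>" using B that by fastforce
    then show ?thesis using s by (simp add: field_simps)
  qed
  then show "\<exists>B. \<forall>c\<in>{c \<in> C. \<alpha> \<le> blinfun_apply f c}. y \<bullet> c \<le> B" by blast
qed

text \<open>Seen from \<open>c0\<close>, every point of \<open>C\<close> outside the slice has
  \<open>f\<close> smaller by at least \<open>e\<close> per unit of distance, because the segment to
  it leaves the slice within distance \<open>R\<close>. A functional within \<open>e\<close> of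
  \<open>f\<close> therefore stays below its value at \<open>c0\<close> outside the slice, and it is
  bounded on the slice itself.\<close>

lemma bounded_slice_imp_interior:
  fixes C :: "'a::real_normed_vector set"
  assumes C: "convex C" and bdd: "bounded {c \<in> C. \<alpha> \<le> blinfun_apply f c}"
    and c0: "c0 \<in> C" "\<alpha> < blinfun_apply f c0"
  shows "f \<in> interior (barrier_cone C)"
proof -
  define \<beta> where "\<beta> = blinfun_apply f c0"
  obtain K where K: "\<And>c. c \<in> C \<Longrightarrow> \<alpha> \<le> blinfun_apply f c \<Longrightarrow> dist c0 c \<le> K"
    using bdd unfolding bounded_any_center[of _ c0] by blast
  \<comment> \<open>\<open>K\<close> may be \<open>0\<close>, while \<open>R\<close> has to serve as
    a denominator.\<close>
  define R where "R = K + 1"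
  have "0 \<le> K" using K[OF c0(1)] c0(2) by simp
  then have R: "R > 0" "\<And>c. c \<in> C \<Longrightarrow> \<alpha> \<le> blinfun_apply f c \<Longrightarrow> norm (c - c0) \<le> R"
    using K by (auto simp: R_def dist_norm norm_minus_commute intro: add_increasing2)
  define e where "e = (\<beta> - \<alpha>) / R"
  have e: "e > 0" using R c0 by (simp add: e_def \<beta>_def)
  have "ball f e \<subseteq> barrier_cone C"
  proof
    fix g assume "g \<in> ball f e"
    then have ng: "norm (g - f) \<le> e" by (simp add: dist_norm norm_minus_commute)
    have "blinfun_apply g c \<le> blinfun_apply g c0 + norm g * R" if c: "c \<in> C" for c
    proof (cases "\<alpha> \<le> blinfun_apply f c")
      case True
      have "blinfun_apply g c - blinfun_apply g c0 = blinfun_apply g (c - c0)"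
        by (simp add: blinfun.bilinear_simps)
      also have "\<dots> \<le> norm g * norm (c - c0)"
        using norm_blinfun[of g "c - c0"] by simp
      also have "\<dots> \<le> norm g * R"
        using R(2)[OF c True] by (intro mult_left_mono) auto
      finally show ?thesis by simp
    next
      case False
      \<comment> \<open>The parameter at which \<open>f\<close> takes the value
        \<open>\<alpha>\<close> on the segment from \<open>c0\<close> to \<open>c\<close>.\<close>
      define t where "t = (\<beta> - \<alpha>) / (\<beta> - blinfun_apply f c)"
      have t: "0 < t" "t < 1" "t * (\<beta> - blinfun_apply f c) = \<beta> - \<alpha>"
        using False c0 by (auto simp: t_def \<beta>_def field_simps)
      have "(1 - t) *\<^sub>R c0 + t *\<^sub>R c \<in> C"
        using C c c0 t by (intro convexD_alt) auto
      moreover have "blinfun_apply f ((1 - t) *\<^sub>R c0 + t *\<^sub>R c) = \<alpha>"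
        using t(3) by (simp add: blinfun.bilinear_simps \<beta>_def algebra_simps)
      ultimately have "norm ((1 - t) *\<^sub>R c0 + t *\<^sub>R c - c0) \<le> R"
        by (intro R(2)) auto
      also have "(1 - t) *\<^sub>R c0 + t *\<^sub>R c - c0 = t *\<^sub>R (c - c0)"
        by (simp add: algebra_simps)
      finally have tR: "t * norm (c - c0) \<le> R" using t by simp
      have "e * (t * norm (c - c0)) \<le> e * R" using tR e by (intro mult_left_mono) auto
      also have "\<dots> = t * (\<beta> - blinfun_apply f c)" using R t by (simp add: e_def)
      finally have "t * (e * norm (c - c0)) \<le> t * (\<beta> - blinfun_apply f c)"
        by (simp add: algebra_simps)
      then have "e * norm (c - c0) \<le> \<beta> - blinfun_apply f c"
        using t(1) by (rule mult_left_le_imp_le)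
      moreover have "blinfun_apply (g - f) (c - c0) \<le> norm (g - f) * norm (c - c0)"
        using norm_blinfun[of "g - f" "c - c0"] by simp
      moreover have "norm (g - f) * norm (c - c0) \<le> e * norm (c - c0)"
        using ng by (intro mult_right_mono) auto
      ultimately have "blinfun_apply (g - f) (c - c0) \<le> \<beta> - blinfun_apply f c"
        by linarith
      then have "blinfun_apply g c \<le> blinfun_apply g c0"
        by (simp add: blinfun.bilinear_simps \<beta>_def)
      moreover have "0 \<le> norm g * R" using R by simp
      ultimately show ?thesis by linarith
    qed
    then show "g \<in> barrier_cone C" by (auto simp: barrier_cone_iff)
  qed
  then show ?thesis using e by (auto simp: mem_interior)
qed

section \<open>Strong separation forces the condition on the barrier cone\<close>

lemma hyperbolic_region:
  fixes f g :: "'a::real_normed_vector \<Rightarrow>\<^sub>L real" and \<sigma> :: real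
  defines "D \<equiv> {z. 0 < blinfun_apply g z \<and> 1 \<le> (blinfun_apply f z - \<sigma>) * blinfun_apply g z}"
  shows "closed D" "convex D"
proof -
  \<comment> \<open>The product vanishes where \<open>g z = 0\<close>, so the strict inequality can
    be relaxed to a closed condition.\<close>
  have "D = {z. 0 \<le> blinfun_apply g z \<and> 1 \<le> (blinfun_apply f z - \<sigma>) * blinfun_apply g z}"
    by (auto simp: D_def less_le)
  then show "closed D"
    by (auto intro!: closed_Collect_conj closed_Collect_le continuous_intros)
  show "convex D"
  proof (rule convexI)
    fix x y and u v :: real
    assume xy: "x \<in> D" "y \<in> D" and uv: "0 \<le> u" "0 \<le> v" "u + v = 1"
    define a b c d where abcd: "a = blinfun_apply f x - \<sigma>" "b = blinfun_apply g x"
      "c = blinfun_apply f y - \<sigma>" "d = blinfun_apply g y"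
    have 1: "b > 0" "1 \<le> a * b" "d > 0" "1 \<le> c * d" using xy by (auto simp: D_def abcd)
    then have 2: "a > 0" "c > 0" by (smt (verit) mult_nonpos_nonneg)+
    \<comment> \<open>The arithmetic-geometric mean inequality bounds the mixed terms
      \<open>a * d + c * b\<close> from below by \<open>2\<close>, which makes the product at the
      convex combination at least \<open>(u + v)\<^sup>2 = 1\<close>.\<close>
    have "1 \<le> (a * b) * (c * d)" using mult_mono[of 1 "a * b" 1 "c * d"] 1 by simp
    also have "\<dots> = (a * d) * (c * b)" by simp
    also have "4 * \<dots> \<le> (a * d + c * b)\<^sup>2"
      using zero_le_power2[of "a * d - c * b"] by (simp add: power2_eq_square algebra_simps)
    finally have "2\<^sup>2 \<le> (a * d + c * b)\<^sup>2" by simp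
    then have "2 \<le> a * d + c * b"
      by (rule power2_le_imp_le) (use 1 2 in \<open>simp add: add_nonneg_nonneg\<close>)
    then have 3: "u * v * 2 \<le> u * v * (a * d + c * b)"
      using uv by (intro mult_left_mono) auto
    have "u * u * 1 \<le> u * u * (a * b)" "v * v * 1 \<le> v * v * (c * d)"
      using 1 uv by (intro mult_left_mono; simp)+
    with 3 have "(u + v)\<^sup>2 \<le> (u * a + v * c) * (u * b + v * d)"
      by (simp add: power2_eq_square algebra_simps)
    moreover have "u * b + v * d > 0"
      using 1 uv by (smt (verit) mult_nonneg_nonneg mult_pos_pos)
    moreover have "blinfun_apply f (u *\<^sub>R x + v *\<^sub>R y) - \<sigma> = u * a + v * c"
    proof -
      have "u * \<sigma> + v * \<sigma> = \<sigma>" using uv by (metis distrib_right mult_1)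
      then show ?thesis by (simp add: abcd blinfun.bilinear_simps algebra_simps)
    qed
    ultimately show "u *\<^sub>R x + v *\<^sub>R y \<in> D"
      using uv by (simp add: D_def blinfun.bilinear_simps abcd)
  qed
qed

text \<open>Otherwise all slices below the supremum \<open>\<sigma>\<close> are unbounded, so there
  are points \<open>x n\<close> of \<open>C\<close> with \<open>f (x n)\<close> tending to
  \<open>\<sigma>\<close> and norms tending to infinity. Some \<open>y\<close> is unbounded above
  along them, and the hyperbolic region built from \<open>f\<close> and \<open>y\<close> comes
  arbitrarily close to \<open>C\<close> without meeting it.\<close>

lemma strong_separation_property_imp_interior:
  fixes C :: "'a::{real_inner, complete_space} set"
  assumes ssp: "strong_separation_property C" and C: "convex C" "C \<noteq> {}"
    and f: "f \<in> barrier_cone C" "f \<noteq> 0"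
  shows "f \<in> interior (barrier_cone C)"
proof (rule ccontr)
  assume nint: "f \<notin> interior (barrier_cone C)"
  define \<sigma> where "\<sigma> = Sup (blinfun_apply f ` C)"
  have bdd: "bdd_above (blinfun_apply f ` C)"
    using f(1) by (auto simp: barrier_cone_iff bdd_above_def)
  have le: "blinfun_apply f c \<le> \<sigma>" if "c \<in> C" for c
    unfolding \<sigma>_def using bdd that by (intro cSup_upper) auto
  have unb: "\<not> bounded {c \<in> C. \<alpha> \<le> blinfun_apply f c}" if lt: "\<alpha> < \<sigma>" for \<alpha>
  proof
    assume "bounded {c \<in> C. \<alpha> \<le> blinfun_apply f c}"
    moreover obtain c0 where "c0 \<in> C" "\<alpha> < blinfun_apply f c0"
      using lt less_cSupD[of "blinfun_apply f ` C" \<alpha>] C(2) by (auto simp: \<sigma>_def)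
    ultimately show False using bounded_slice_imp_interior[OF C(1)] nint by blast
  qed
  have "\<exists>x\<in>C. \<sigma> - inverse (real (Suc n)) \<le> blinfun_apply f x \<and> real n < norm x" for n
    using unb[of "\<sigma> - inverse (real (Suc n))"] by (auto simp: bounded_iff not_le)
  then obtain x where x: "\<And>n. x n \<in> C" "\<And>n. \<sigma> - inverse (real (Suc n)) \<le> blinfun_apply f (x n)"
    "\<And>n. real n < norm (x n)" by metis
  have "\<not> bounded (range x)"
  proof
    assume "bounded (range x)"
    then obtain B where B: "\<And>n. norm (x n) \<le> B" by (auto simp: bounded_iff)
    obtain n where "B \<le> real n" using real_arch_simple by blast
    with B[of n] x(3)[of n] show False by linarith
  qed
  then obtain y where y: "\<And>B. \<exists>n. B < y \<bullet> x n"
    using pointwise_bounded_imp_bounded[of "range x"] unfolding ball_simps not_le[symmetric] by blast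
  \<comment> \<open>Large values must occur at late indices, where \<open>f (x n)\<close> is already
    near \<open>\<sigma>\<close>; the maximum over the first \<open>N\<close> terms excludes early
    ones.\<close>
  have large: "\<exists>n\<ge>N. B < y \<bullet> x n" for N B
  proof -
    define B' where "B' = Max (insert B ((\<lambda>n. y \<bullet> x n) ` {..<N}))"
    obtain n where n: "B' < y \<bullet> x n" using y by blast
    have "B \<le> B'" unfolding B'_def by (intro Max_ge) auto
    moreover have "\<not> n < N"
    proof
      assume "n < N"
      then have "y \<bullet> x n \<le> B'" unfolding B'_def by (intro Max_ge) auto
      with n show False by simp
    qed
    ultimately show ?thesis using n by (intro exI[of _ n]) auto
  qed
  define g where "g = blinfun_inner_right y"
  have g: "blinfun_apply g z = y \<bullet> z" for z by (simp add: g_def)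
  define D where "D = {z. 0 < blinfun_apply g z \<and> 1 \<le> (blinfun_apply f z - \<sigma>) * blinfun_apply g z}"
  obtain u' where u': "blinfun_apply f u' \<noteq> 0"
    using f(2) by (metis blinfun_eqI zero_blinfun.rep_eq)
  \<comment> \<open>Normalised so that a shift by \<open>e *\<^sub>R u\<close> raises
    \<open>f\<close> by exactly \<open>e\<close>.\<close>
  define u where "u = (1 / blinfun_apply f u') *\<^sub>R u'"
  have u: "blinfun_apply f u = 1" using u' by (simp add: u_def blinfun.bilinear_simps)
  have near: "\<exists>c\<in>C. c + e *\<^sub>R u \<in> D" if e: "e > 0" for e
  proof -
    \<comment> \<open>After the shift, \<open>f - \<sigma>\<close> is at least \<open>e / 2\<close>
      and \<open>g\<close> at least \<open>2 / e\<close>, so their product reaches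
      \<open>1\<close>.\<close>
    obtain N where N: "inverse (real (Suc N)) < e / 2"
      using reals_Archimedean[of "e/2"] e by auto
    obtain n where n: "n \<ge> N" "2 / e - e * (y \<bullet> u) < y \<bullet> x n" using large by blast
    have "inverse (real (Suc n)) \<le> inverse (real (Suc N))"
      using n by (simp add: field_simps)
    moreover have "blinfun_apply f (x n + e *\<^sub>R u) = blinfun_apply f (x n) + e"
      by (simp add: blinfun.bilinear_simps u)
    ultimately have 1: "e / 2 \<le> blinfun_apply f (x n + e *\<^sub>R u) - \<sigma>"
      using x(2)[of n] N by linarith
    have 2: "2 / e \<le> blinfun_apply g (x n + e *\<^sub>R u)"
      using n by (simp add: g inner_simps)
    have "1 = (e / 2) * (2 / e)" using e by simp
    also have "\<dots> \<le> (blinfun_apply f (x n + e *\<^sub>R u) - \<sigma>) * blinfun_apply g (x n + e *\<^sub>R u)"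
      using 1 2 e by (intro mult_mono) auto
    finally have "x n + e *\<^sub>R u \<in> D"
      using 2 e by (auto simp: D_def intro: less_le_trans[of 0 "2 / e"])
    then show ?thesis using x(1) by blast
  qed
  have "C \<inter> D = {}"
  proof -
    have False if "c \<in> C" "c \<in> D" for c
    proof -
      have "(blinfun_apply f c - \<sigma>) * blinfun_apply g c \<le> 0"
        using le[OF that(1)] that(2) by (intro mult_nonpos_nonneg) (auto simp: D_def)
      with that(2) show False by (auto simp: D_def)
    qed
    then show ?thesis by blast
  qed
  moreover have "D \<noteq> {}" using near[of 1] by auto
  moreover have "closed D" "convex D" unfolding D_def by (rule hyperbolic_region)+
  ultimately have "strongly_separated C D"
    using ssp by (auto simp: strong_separation_property_def)
  then obtain h and a b :: real where h: "a < b" "\<And>c. c \<in> C \<Longrightarrow> blinfun_apply h c \<le> a"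
    "\<And>d. d \<in> D \<Longrightarrow> b \<le> blinfun_apply h d"
    unfolding strongly_separated_iff by blast
  \<comment> \<open>Along \<open>e *\<^sub>R u\<close> the functional \<open>h\<close> gains at most
    \<open>(b - a) / 2\<close>, whereas passing from \<open>C\<close> to \<open>D\<close> requires a
    gain of at least \<open>b - a\<close>.\<close>
  define e where "e = (b - a) / (2 * (\<bar>blinfun_apply h u\<bar> + 1))"
  have e: "e > 0" using h by (simp add: e_def)
  obtain c where c: "c \<in> C" "c + e *\<^sub>R u \<in> D" using near[OF e] by blast
  have "b - a \<le> e * blinfun_apply h u"
    using h(2)[OF c(1)] h(3)[OF c(2)] by (simp add: blinfun.bilinear_simps)
  also have "\<dots> \<le> e * (\<bar>blinfun_apply h u\<bar> + 1)" using e by (intro mult_left_mono) auto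
  also have "\<dots> = (b - a) / 2" by (simp add: e_def field_simps add_pos_pos add_nonneg_eq_0_iff)
  finally show False using h(1) by simp
qed

section \<open>Recession directions and nonempty interior\<close>

text \<open>The set \<open>A n\<close> collects directions, normalised by \<open>f\<close>, along
  which \<open>C\<close> can be followed from \<open>c0\<close> up to parameter
  \<open>Suc n\<close>. These sets are nested by convexity, and \<open>A 0\<close> is bounded
  because it is part of a translated slice; a common point is a recession direction.\<close>

lemma recession_direction_exists:
  fixes C :: "'a::{real_inner, complete_space} set"
  assumes C: "closed C" "convex C" "\<not> bounded C" and f: "f \<in> interior (barrier_cone C)"
  shows "\<exists>v. blinfun_apply f v = -1 \<and> (\<forall>c\<in>C. \<forall>t\<ge>0. c + t *\<^sub>R v \<in> C)"
proof -
  obtain c0 where c0: "c0 \<in> C" using C(3) by fastforce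
  define A where "A n = {w. blinfun_apply f w = -1 \<and> c0 + real (Suc n) *\<^sub>R w \<in> C}" for n
  have "(\<Inter>n. A n) \<noteq> {}"
  proof (rule nested_closed_convex_Inter_nonempty)
    fix n
    have "closed ((\<lambda>w. c0 + real (Suc n) *\<^sub>R w) -` C)"
      using C(1) by (intro closed_vimage continuous_intros)
    then show "closed (A n)"
      unfolding A_def vimage_def by (intro closed_Collect_conj closed_Collect_eq continuous_intros)
    show "convex (A n)"
    proof (rule convexI)
      fix x y and u v :: real
      assume xy: "x \<in> A n" "y \<in> A n" and uv: "0 \<le> u" "0 \<le> v" "u + v = 1"
      have "u *\<^sub>R (c0 + real (Suc n) *\<^sub>R x) + v *\<^sub>R (c0 + real (Suc n) *\<^sub>R y) \<in> C"
        using xy uv C(2) by (intro convexD) (auto simp: A_def)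
      also have "u *\<^sub>R (c0 + real (Suc n) *\<^sub>R x) + v *\<^sub>R (c0 + real (Suc n) *\<^sub>R y)
          = (u + v) *\<^sub>R c0 + real (Suc n) *\<^sub>R (u *\<^sub>R x + v *\<^sub>R y)"
        by (simp only: scaleR_add_left scaleR_add_right scaleR_scaleR mult.commute add_ac)
      finally show "u *\<^sub>R x + v *\<^sub>R y \<in> A n"
        using xy uv by (simp add: A_def blinfun.bilinear_simps)
    qed
    show "A n \<noteq> {}"
    proof -
      \<comment> \<open>If \<open>f\<close> did not go this low on \<open>C\<close>, then
        \<open>C\<close> would equal one of its own slices and be bounded.\<close>
      obtain c where c: "c \<in> C" "blinfun_apply f c < blinfun_apply f c0 - real (Suc n)"
      proof (rule ccontr)
        assume "\<not> thesis"
        then have "C \<subseteq> {c \<in> C. blinfun_apply f c0 - real (Suc n) \<le> blinfun_apply f c}"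
          using that by (auto simp: not_less[symmetric])
        then show False using bounded_slice[OF f] C(3) bounded_subset by blast
      qed
      define s where "s = blinfun_apply f c0 - blinfun_apply f c"
      have s: "s > real (Suc n)" using c by (simp add: s_def)
      then have s0: "s > 0" by linarith
      \<comment> \<open>The chord from \<open>c0\<close> to \<open>c\<close>, rescaled to
        \<open>f w = -1\<close>; since \<open>s > Suc n\<close>, the point at parameter
        \<open>Suc n\<close> still lies on the chord.\<close>
      define w where "w = (1 / s) *\<^sub>R (c - c0)"
      have "blinfun_apply f (c - c0) = - s" by (simp add: s_def blinfun.bilinear_simps)
      then have "blinfun_apply f w = -1"
        using s0 by (simp add: w_def blinfun.scaleR_right)
      moreover have "(1 - real (Suc n) / s) *\<^sub>R c0 + (real (Suc n) / s) *\<^sub>R c \<in> C"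
        using c c0 C s s0 by (intro convexD_alt) auto
      then have "c0 + real (Suc n) *\<^sub>R w \<in> C"
        by (simp add: w_def scaleR_diff_left scaleR_diff_right algebra_simps del: of_nat_Suc)
      ultimately show ?thesis by (auto simp: A_def)
    qed
  next
    fix m n :: nat assume mn: "m \<le> n"
    show "A n \<subseteq> A m"
    proof
      fix w assume w: "w \<in> A n"
      define s where "s = real (Suc m) / real (Suc n)"
      have s: "0 \<le> s" "s \<le> 1" "s * real (Suc n) = real (Suc m)" using mn by (auto simp: s_def)
      have "(1 - s) *\<^sub>R c0 + s *\<^sub>R (c0 + real (Suc n) *\<^sub>R w) \<in> C"
        using w s C c0 by (intro convexD_alt) (auto simp: A_def)
      also have "(1 - s) *\<^sub>R c0 + s *\<^sub>R (c0 + real (Suc n) *\<^sub>R w) = c0 + (s * real (Suc n)) *\<^sub>R w"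
        by (simp only: scaleR_add_right scaleR_scaleR scaleR_diff_left scaleR_one) simp
      finally show "w \<in> A m" using w s by (simp add: A_def)
    qed
  next
    have "A 0 \<subseteq> (\<lambda>c. c - c0) ` {c \<in> C. blinfun_apply f c0 - 1 \<le> blinfun_apply f c}"
    proof
      fix w assume "w \<in> A 0"
      then show "w \<in> (\<lambda>c. c - c0) ` {c \<in> C. blinfun_apply f c0 - 1 \<le> blinfun_apply f c}"
        by (intro image_eqI[of _ _ "c0 + w"]) (auto simp: A_def blinfun.bilinear_simps)
    qed
    then show "bounded (A 0)"
      using bounded_slice[OF f] bounded_translation_minus bounded_subset by blast
  qed
  then obtain v where v: "\<And>n. v \<in> A n" by blast
  have "c + t *\<^sub>R v \<in> C" if c: "c \<in> C" and t: "t \<ge> 0" for c t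
  proof (rule Lim_in_closed_set[OF C(1)])
    \<comment> \<open>To carry the direction from \<open>c0\<close> over to \<open>c\<close>, take
      the point at ratio \<open>t / Suc n\<close> on the segment from \<open>c\<close> to
      \<open>c0 + real (Suc n) *\<^sub>R v\<close>; it tends to
      \<open>c + t *\<^sub>R v\<close>.\<close>
    let ?x = "\<lambda>n. c + t *\<^sub>R v + (t * inverse (real (Suc n))) *\<^sub>R (c0 - c)"
    have "?x \<longlonglongrightarrow> c + t *\<^sub>R v + (t * 0) *\<^sub>R (c0 - c)"
      by (intro tendsto_intros LIMSEQ_inverse_real_of_nat)
    then show "?x \<longlonglongrightarrow> c + t *\<^sub>R v" by simp
    obtain N where N: "t \<le> real N" using real_arch_simple by blast
    have "?x n \<in> C" if "n \<ge> N" for n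
    proof -
      define s where "s = t * inverse (real (Suc n))"
      have s: "0 \<le> s" "s \<le> 1" "s * real (Suc n) = t"
        using t N that by (auto simp: s_def field_simps)
      have "(1 - s) *\<^sub>R c + s *\<^sub>R (c0 + real (Suc n) *\<^sub>R v) \<in> C"
        using v[of n] s C c by (intro convexD_alt) (auto simp: A_def)
      also have "(1 - s) *\<^sub>R c + s *\<^sub>R (c0 + real (Suc n) *\<^sub>R v)
          = c + (s * real (Suc n)) *\<^sub>R v + s *\<^sub>R (c0 - c)"
        by (simp only: scaleR_add_right scaleR_scaleR scaleR_diff_left scaleR_diff_right scaleR_one) simp
      finally show ?thesis unfolding s(3) unfolding s_def .
    qed
    then show "\<forall>\<^sub>F n in sequentially. ?x n \<in> C"
      by (auto simp: eventually_sequentially)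
  qed simp
  with v[of 0] show ?thesis by (auto simp: A_def)
qed

text \<open>If \<open>f\<close> were constant along \<open>v\<close>, the whole ray from
  \<open>c\<close> would lie in the slice at level \<open>f c\<close>, which is bounded.\<close>

lemma interior_barrier_cone_recession_nonzero:
  fixes C :: "'a::{real_inner, complete_space} set"
  assumes f: "f \<in> interior (barrier_cone C)" and v: "v \<noteq> 0" "\<And>t. t \<ge> 0 \<Longrightarrow> c + t *\<^sub>R v \<in> C"
  shows "blinfun_apply f v \<noteq> 0"
proof
  assume fv: "blinfun_apply f v = 0"
  obtain K where K: "\<And>x. x \<in> C \<Longrightarrow> blinfun_apply f c \<le> blinfun_apply f x \<Longrightarrow> norm x \<le> K"
    using bounded_slice[OF f, of "blinfun_apply f c"] by (auto simp: bounded_iff)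
  have *: "norm (c + t *\<^sub>R v) \<le> K" if "t \<ge> 0" for t
    using v(2)[OF that] by (intro K) (auto simp: blinfun.bilinear_simps fv)
  have "norm c \<le> K" using *[of 0] by simp
  then have K0: "0 \<le> K" using norm_ge_zero order_trans by blast
  \<comment> \<open>Makes the norm of \<open>t *\<^sub>R v\<close> exceed \<open>K + norm c\<close>,
    the largest value the triangle inequality allows.\<close>
  define t where "t = (K + norm c + 1) / norm v"
  have t: "t \<ge> 0" "t * norm v = K + norm c + 1"
    using v(1) K0 by (auto simp: t_def)
  have "norm (t *\<^sub>R v) \<le> norm (c + t *\<^sub>R v) + norm c"
    using norm_triangle_ineq4[of "c + t *\<^sub>R v" c] by simp
  with *[OF t(1)] t show False by simp
qed

text \<open>A point outside \<open>C\<close> can be strictly separated from \<open>C\<close>, and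
  the separating functional, with its sign reversed, is a nonzero member of the barrier
  cone.\<close>

lemma barrier_cone_trivial_imp_UNIV:
  fixes C :: "'a::{real_inner, complete_space} set"
  assumes C: "closed C" "convex C" "C \<noteq> {}" and bar: "barrier_cone C \<subseteq> {0}"
  shows "C = UNIV"
proof (rule ccontr)
  assume "C \<noteq> UNIV"
  then obtain x where x: "x \<notin> C" by auto
  have "closed ((\<lambda>c. c - x) ` C)" "convex ((\<lambda>c. c - x) ` C)"
    using C closed_translation_subtract convex_translation_subtract by blast+
  moreover have "(\<lambda>c. c - x) ` C \<noteq> {}" "0 \<notin> (\<lambda>c. c - x) ` C" using C(3) x by auto
  ultimately obtain y where y: "y \<noteq> 0" "\<And>c. c \<in> C \<Longrightarrow> y \<bullet> y \<le> y \<bullet> (c - x)"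
    using strict_separation_from_0[of "(\<lambda>c. c - x) ` C"] by blast
  have "blinfun_apply (blinfun_inner_right (- y)) c \<le> - (y \<bullet> x)" if "c \<in> C" for c
    using order_trans[OF inner_ge_zero y(2)[OF that]] by (simp add: inner_diff_right)
  then have "blinfun_inner_right (- y) \<in> barrier_cone C"
    unfolding barrier_cone_iff by blast
  then have "blinfun_inner_right (- y) = 0" using bar by blast
  with y(1) show False by simp
qed

text \<open>When the barrier cone has interior points, the sets \<open>F n\<close> are translates of
  \<open>C\<close> along a recession direction \<open>v\<close>, closed and without interior. They
  cannot cover the space, and a point outside all of them spans a line parallel to \<open>v\<close>
  that misses \<open>C\<close>.\<close>

lemma strong_separation_property_imp_interior_nonempty:
  fixes C :: "'a::{real_inner, complete_space} set"
  assumes ssp: "strong_separation_property C" and C: "closed C" "convex C" "\<not> bounded C"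
  shows "interior C \<noteq> {}"
proof
  assume empty: "interior C = {}"
  have ne: "C \<noteq> {}" using C(3) by auto
  show False
  proof (cases "interior (barrier_cone C) = {}")
    case True
    then have "barrier_cone C \<subseteq> {0}"
      using strong_separation_property_imp_interior[OF ssp C(2) ne] by blast
    then have "C = UNIV" using barrier_cone_trivial_imp_UNIV C ne by auto
    with empty show False by simp
  next
    case False
    then obtain f where "f \<in> interior (barrier_cone C)" by blast
    then obtain v where v: "blinfun_apply f v = -1" "\<And>c t. c \<in> C \<Longrightarrow> t \<ge> 0 \<Longrightarrow> c + t *\<^sub>R v \<in> C"
      using recession_direction_exists[OF C] by blast
    then have v0: "v \<noteq> 0" by (auto simp: blinfun.bilinear_simps)
    define F where "F n = {x. x + real n *\<^sub>R v \<in> C}" for n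
    have "closed ((\<lambda>x. x + real n *\<^sub>R v) -` C)" for n
      using C(1) by (intro closed_vimage continuous_intros)
    then have Fcl: "closed (F n)" for n by (simp add: F_def vimage_def)
    have Fint: "interior (F n) = {}" for n
    proof (rule ccontr)
      assume "interior (F n) \<noteq> {}"
      then obtain a e where e: "e > 0" "ball a e \<subseteq> F n" using mem_interior by blast
      have "ball (a + real n *\<^sub>R v) e \<subseteq> C"
      proof
        fix z assume "z \<in> ball (a + real n *\<^sub>R v) e"
        then have "z - real n *\<^sub>R v \<in> ball a e" by (simp add: dist_norm algebra_simps)
        with e have "z - real n *\<^sub>R v \<in> F n" by blast
        then show "z \<in> C" by (simp add: F_def)
      qed
      with e empty show False using mem_interior by blast
    qed
    have "(\<Union>n. F n) \<noteq> UNIV" using Baire_closed_Union[of F] Fcl Fint by blast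
    then obtain x where x: "\<And>n. x \<notin> F n" by blast
    define D where "D = range (\<lambda>t. x + t *\<^sub>R v)"
    \<comment> \<open>As \<open>f v = -1\<close>, the parameter of a point \<open>z\<close> on the
      line is \<open>- f (z - x)\<close>, which turns membership into a closed equation.\<close>
    have "D = {z. z = x - blinfun_apply f (z - x) *\<^sub>R v}"
    proof (intro set_eqI iffI)
      fix z assume "z \<in> {z. z = x - blinfun_apply f (z - x) *\<^sub>R v}"
      then have "z = x + (- blinfun_apply f (z - x)) *\<^sub>R v" by simp
      then show "z \<in> D" unfolding D_def by (rule image_eqI) simp
    qed (auto simp: D_def blinfun.bilinear_simps v)
    then have "closed D" by (auto intro!: closed_Collect_eq continuous_intros)
    moreover have "convex D"
    proof (rule convexI)
      fix y z and a b :: real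
      assume "y \<in> D" "z \<in> D" and ab: "0 \<le> a" "0 \<le> b" "a + b = 1"
      then obtain s t where st: "y = x + s *\<^sub>R v" "z = x + t *\<^sub>R v" by (auto simp: D_def)
      have "a *\<^sub>R y + b *\<^sub>R z = (a + b) *\<^sub>R x + (a * s + b * t) *\<^sub>R v"
        by (simp add: st algebra_simps)
      then have "a *\<^sub>R y + b *\<^sub>R z = x + (a * s + b * t) *\<^sub>R v" using ab by simp
      then show "a *\<^sub>R y + b *\<^sub>R z \<in> D" unfolding D_def by (rule image_eqI) simp
    qed
    moreover have "C \<inter> D = {}"
    proof -
      \<comment> \<open>Once the line meets \<open>C\<close> at parameter \<open>t\<close>,
        recession keeps it in \<open>C\<close> at every natural \<open>n \<ge> t\<close>.\<close>
      have False if xt: "x + t *\<^sub>R v \<in> C" for t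
      proof -
        obtain n where n: "t \<le> real n" using real_arch_simple by blast
        have "x + t *\<^sub>R v + (real n - t) *\<^sub>R v \<in> C" using v(2)[OF xt] n by simp
        then have "x \<in> F n" by (simp add: F_def algebra_simps)
        with x show False by blast
      qed
      then show ?thesis by (auto simp: D_def)
    qed
    moreover have "D \<noteq> {}" by (simp add: D_def)
    ultimately have "strongly_separated C D"
      using ssp by (auto simp: strong_separation_property_def)
    then obtain h and a b :: real where h: "h \<noteq> 0" "\<forall>c\<in>C. blinfun_apply h c \<le> a" "\<forall>d\<in>D. b \<le> blinfun_apply h d"
      by (auto simp: strongly_separated_iff)
    \<comment> \<open>A functional bounded below on a full line is constant along it.\<close>
    have "blinfun_apply h v = 0"
    proof (rule ccontr)
      assume hv: "blinfun_apply h v \<noteq> 0"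
      define t where "t = (b - blinfun_apply h x - 1) / blinfun_apply h v"
      have "x + t *\<^sub>R v \<in> D" unfolding D_def by (rule rangeI)
      with h(3) have "b \<le> blinfun_apply h (x + t *\<^sub>R v)" by blast
      with hv show False by (simp add: blinfun.bilinear_simps t_def)
    qed
    moreover have "h \<in> interior (barrier_cone C)"
      using strong_separation_property_imp_interior[OF ssp C(2) ne] h by (auto simp: barrier_cone_iff)
    moreover obtain c where "c \<in> C" using ne by blast
    ultimately show False
      using interior_barrier_cone_recession_nonzero[of h C v c] v0 v(2) by blast
  qed
qed

section \<open>The converse: weak separation, positive distance and slices near
  \<open>D\<close>\<close>

text \<open>For each small \<open>t > 0\<close> the point \<open>- t *\<^sub>R p\<close> lies
  outside the closure of \<open>E\<close> and can be strictly separated from it. With the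
  normalisation \<open>z \<bullet> p = 1\<close> the ball around \<open>p\<close> bounds these
  functionals, so the nested sets of approximate solutions have a common point.\<close>

lemma weak_separation_from_0:
  fixes E :: "'a::{real_inner, complete_space} set"
  assumes E: "convex E" "0 \<notin> E" and r: "r > 0" "cball p r \<subseteq> E"
  shows "\<exists>y. y \<noteq> 0 \<and> (\<forall>x\<in>E. 0 \<le> y \<bullet> x)"
proof -
  define A where "A n = {z. z \<bullet> p = 1 \<and> (\<forall>x\<in>E. - inverse (real (Suc n)) \<le> z \<bullet> x)}" for n
  have pE: "p \<in> E" using r by auto
  have "(\<Inter>n. A n) \<noteq> {}"
  proof (rule nested_closed_convex_Inter_nonempty)
    fix n
    define t where "t = inverse (real (Suc n))"
    have t: "t > 0" by (simp add: t_def)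
    have "A n = {z. z \<bullet> p = 1} \<inter> (\<Inter>x\<in>E. {z. - t \<le> z \<bullet> x})"
      by (auto simp: A_def t_def)
    then show "closed (A n)"
      by (auto intro!: closed_INT closed_Int closed_Collect_le closed_Collect_eq continuous_intros)
    show "convex (A n)"
    proof (rule convexI)
      fix x y and u v :: real
      assume xy: "x \<in> A n" "y \<in> A n" and uv: "0 \<le> u" "0 \<le> v" "u + v = 1"
      have "- t \<le> u * (x \<bullet> e) + v * (y \<bullet> e)" if "e \<in> E" for e
      proof -
        have "- t \<le> x \<bullet> e" "- t \<le> y \<bullet> e"
          using xy that unfolding A_def t_def by blast+
        then have "u * (- t) \<le> u * (x \<bullet> e)" "v * (- t) \<le> v * (y \<bullet> e)"
          using uv by (simp_all only: mult_left_mono)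
        moreover have "u * (- t) + v * (- t) = - t" using uv by (metis distrib_right mult_1)
        ultimately show ?thesis by linarith
      qed
      then show "u *\<^sub>R x + v *\<^sub>R y \<in> A n"
        using xy uv by (auto simp: A_def inner_simps t_def)
    qed
    show "A n \<noteq> {}"
    proof -
      \<comment> \<open>A point \<open>e\<close> of \<open>E\<close> within \<open>t * r\<close> of
        \<open>- t *\<^sub>R p\<close> would have its opposite multiple \<open>q\<close> in the ball
        around \<open>p\<close>; then the origin would lie on the segment from \<open>e\<close> to
        \<open>q\<close>, hence in \<open>E\<close>.\<close>
      have "- t *\<^sub>R p \<notin> closure E"
      proof
        assume "- t *\<^sub>R p \<in> closure E"
        then obtain e where e: "e \<in> E" "dist e (- t *\<^sub>R p) < t * r"
          using t r closure_approachable[of "- t *\<^sub>R p" E] by (meson mult_pos_pos)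
        define q where "q = - (1 / t) *\<^sub>R e"
        have "t * dist p q = norm (t *\<^sub>R (p - q))" using t by (simp add: dist_norm)
        also have "t *\<^sub>R (p - q) = e - (- t *\<^sub>R p)" using t by (simp add: q_def algebra_simps)
        also have "norm \<dots> < t * r" using e by (simp add: dist_norm)
        finally have "q \<in> E" using t r by auto
        then have "(1 - t / (1 + t)) *\<^sub>R e + (t / (1 + t)) *\<^sub>R q \<in> E"
          using E e t by (intro convexD_alt) auto
        also have "(1 - t / (1 + t)) *\<^sub>R e + (t / (1 + t)) *\<^sub>R q
            = (1 - t / (1 + t) - (t / (1 + t)) * (1 / t)) *\<^sub>R e"
          by (simp add: q_def scaleR_diff_left)
        also have "1 - t / (1 + t) - (t / (1 + t)) * (1 / t) = 0"
          using t by (simp add: field_simps)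
        finally show False using E by simp
      qed
      moreover have "closed ((\<lambda>x. x - (- t *\<^sub>R p)) ` closure E)"
        "convex ((\<lambda>x. x - (- t *\<^sub>R p)) ` closure E)"
        using E closed_translation_subtract convex_translation_subtract by blast+
      moreover have "(\<lambda>x. x - (- t *\<^sub>R p)) ` closure E \<noteq> {}" using pE by auto
      moreover have "0 \<notin> (\<lambda>x. x - (- t *\<^sub>R p)) ` closure E"
        using \<open>- t *\<^sub>R p \<notin> closure E\<close> by (metis eq_iff_diff_eq_0 imageE)
      ultimately obtain y where y: "y \<noteq> 0"
        "\<And>x. x \<in> closure E \<Longrightarrow> y \<bullet> y \<le> y \<bullet> (x - (- t *\<^sub>R p))"
        using strict_separation_from_0[of "(\<lambda>x. x - (- t *\<^sub>R p)) ` closure E"] by blast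
      have yx: "0 < y \<bullet> x + t * (y \<bullet> p)" if "x \<in> E" for x
      proof -
        have "x \<in> closure E" using that closure_subset by blast
        then have "y \<bullet> y \<le> y \<bullet> x + t * (y \<bullet> p)" using y(2) by (simp add: inner_simps)
        moreover have "0 < y \<bullet> y" using y(1) by simp
        ultimately show ?thesis by linarith
      qed
      \<comment> \<open>Testing at the ball point where \<open>y\<close> is smallest forces
        \<open>y \<bullet> p > 0\<close>, so \<open>y\<close> can be normalised.\<close>
      have "p - (r / norm y) *\<^sub>R y \<in> E"
        using r y(1) by (intro subsetD[OF r(2)]) (simp add: dist_norm)
      from yx[OF this] have "0 < (1 + t) * (y \<bullet> p) - (r / norm y) * (y \<bullet> y)"
        by (simp add: inner_simps algebra_simps)
      moreover have "(r / norm y) * (y \<bullet> y) \<ge> 0" using r by simp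
      ultimately have "(1 + t) * (y \<bullet> p) > 0" by linarith
      then have yp: "y \<bullet> p > 0" using t by (simp add: zero_less_mult_iff)
      define z where "z = (1 / (y \<bullet> p)) *\<^sub>R y"
      have "z \<bullet> p = 1" using yp by (simp add: z_def)
      moreover have "- t \<le> z \<bullet> x" if "x \<in> E" for x
        using yx[OF that] yp by (simp add: z_def field_simps)
      ultimately show ?thesis by (auto simp: A_def t_def)
    qed
  next
    fix m n :: nat assume "m \<le> n"
    then have "- inverse (real (Suc m)) \<le> - inverse (real (Suc n))" by (simp add: field_simps)
    then show "A n \<subseteq> A m" unfolding A_def using order_trans by blast
  next
    \<comment> \<open>The same test point gives \<open>- 1 \<le> 1 - r * norm z\<close>.\<close>
    have "norm z \<le> 2 / r" if z: "z \<in> A 0" for z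
    proof (cases "z = 0")
      case False
      have "p - (r / norm z) *\<^sub>R z \<in> E"
        using r False by (intro subsetD[OF r(2)]) (simp add: dist_norm)
      then have "- 1 \<le> z \<bullet> p - (r / norm z) * (z \<bullet> z)"
        using z unfolding A_def by (force simp: inner_simps)
      moreover have "(r / norm z) * (z \<bullet> z) = r * norm z"
        using False by (simp add: dot_square_norm power2_eq_square)
      ultimately have "r * norm z \<le> 2" using z by (simp add: A_def)
      then show ?thesis using r by (simp add: field_simps)
    qed (use r in simp)
    then show "bounded (A 0)" by (auto simp: bounded_iff)
  qed
  then obtain z where z: "\<And>n. z \<in> A n" by blast
  have "0 \<le> z \<bullet> x" if x: "x \<in> E" for x
  proof (rule ccontr)
    assume "\<not> 0 \<le> z \<bullet> x"
    then obtain n where "inverse (real (Suc n)) < - (z \<bullet> x)"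
      using reals_Archimedean[of "- (z \<bullet> x)"] by auto
    moreover have "- inverse (real (Suc n)) \<le> z \<bullet> x" using z[of n] x unfolding A_def by blast
    ultimately show False by linarith
  qed
  moreover have "z \<noteq> 0" using z[of 0] by (auto simp: A_def)
  ultimately show ?thesis by blast
qed

text \<open>The origin is outside the closure of the difference set \<open>E\<close>. The strict
  separation of that closure from the origin leaves a gap of \<open>y \<bullet> y\<close> between
  the values of \<open>y\<close> on \<open>C\<close> and on \<open>D\<close>.\<close>

lemma strongly_separated_if_dist_ge:
  fixes C D :: "'a::{real_inner, complete_space} set"
  assumes C: "convex C" "C \<noteq> {}" and D: "convex D" "D \<noteq> {}"
    and e: "e > 0" "\<And>c d. c \<in> C \<Longrightarrow> d \<in> D \<Longrightarrow> e \<le> dist c d"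
  shows "strongly_separated C D"
proof -
  define E where "E = (\<Union>d\<in>D. \<Union>c\<in>C. {d - c})"
  have "convex E" unfolding E_def using C D by (intro convex_differences)
  moreover have "0 \<notin> closure E"
  proof
    assume "0 \<in> closure E"
    then obtain x where "x \<in> E" "dist x 0 < e" using e(1) closure_approachable by blast
    then show False using e(2) by (force simp: E_def dist_norm norm_minus_commute)
  qed
  moreover have "E \<noteq> {}" using C D by (auto simp: E_def)
  ultimately obtain y where y: "y \<noteq> 0" "\<And>x. x \<in> closure E \<Longrightarrow> y \<bullet> y \<le> y \<bullet> x"
    using strict_separation_from_0[of "closure E"] by auto
  have *: "y \<bullet> c + y \<bullet> y \<le> y \<bullet> d" if "c \<in> C" "d \<in> D" for c d
  proof -
    have "d - c \<in> closure E" using that closure_subset[of E] by (auto simp: E_def)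
    from y(2)[OF this] show ?thesis by (simp add: inner_diff_right)
  qed
  obtain d0 where d0: "d0 \<in> D" using D by blast
  define a where "a = (SUP c\<in>C. y \<bullet> c)"
  have "bdd_above ((\<lambda>c. y \<bullet> c) ` C)"
    using *[OF _ d0] by (intro bdd_aboveI2[of _ _ "y \<bullet> d0 - y \<bullet> y"]) (simp add: le_diff_eq)
  then have "y \<bullet> c \<le> a" if "c \<in> C" for c unfolding a_def using that by (intro cSUP_upper)
  moreover have "a + y \<bullet> y \<le> y \<bullet> d" if "d \<in> D" for d
  proof -
    have "a \<le> y \<bullet> d - y \<bullet> y"
      unfolding a_def using *[OF _ that] C by (intro cSUP_least) (auto simp: le_diff_eq)
    then show ?thesis by simp
  qed
  moreover have "a < a + y \<bullet> y" using y by simp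
  ultimately show ?thesis
    unfolding strongly_separated_iff using y(1)
    by (metis blinfun_inner_right.rep_eq blinfun_inner_right_eq_0_iff)
qed

text \<open>Distances to \<open>D\<close> need not be attained, so points of \<open>D\<close> within
  \<open>e + k\<close> are combined convexly, and \<open>k > 0\<close> is arbitrary.\<close>

lemma convex_infdist_le:
  fixes D :: "'a::real_normed_vector set"
  assumes D: "convex D" "D \<noteq> {}"
  shows "convex {x. infdist x D \<le> e}"
proof (rule convexI)
  fix x y and u v :: real
  assume xy: "x \<in> {x. infdist x D \<le> e}" "y \<in> {x. infdist x D \<le> e}"
    and uv: "0 \<le> u" "0 \<le> v" "u + v = 1"
  have "infdist (u *\<^sub>R x + v *\<^sub>R y) D \<le> e + k" if k: "k > 0" for k
  proof -
    have "\<exists>d\<in>D. dist z d < e + k" if "infdist z D \<le> e" for z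
      using that k D(2) cInf_lessD[of "dist z ` D" "e + k"] by (auto simp: infdist_notempty)
    then obtain a b where ab: "a \<in> D" "dist x a < e + k" "b \<in> D" "dist y b < e + k"
      using xy by blast
    have "dist (u *\<^sub>R x + v *\<^sub>R y) (u *\<^sub>R a + v *\<^sub>R b) = norm (u *\<^sub>R (x - a) + v *\<^sub>R (y - b))"
      by (simp add: dist_norm algebra_simps)
    also have "\<dots> \<le> u * dist x a + v * dist y b"
      using norm_triangle_ineq[of "u *\<^sub>R (x - a)" "v *\<^sub>R (y - b)"] uv by (simp add: dist_norm)
    also have "\<dots> \<le> u * (e + k) + v * (e + k)"
      using ab uv by (intro add_mono mult_left_mono) auto
    also have "\<dots> = e + k" using uv by (metis distrib_right mult_1)
    finally have "dist (u *\<^sub>R x + v *\<^sub>R y) (u *\<^sub>R a + v *\<^sub>R b) \<le> e + k" .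
    moreover have "u *\<^sub>R a + v *\<^sub>R b \<in> D" using D ab uv by (intro convexD) auto
    ultimately show ?thesis using infdist_le2 by blast
  qed
  then show "u *\<^sub>R x + v *\<^sub>R y \<in> {x. infdist x D \<le> e}"
    by (auto intro: field_le_epsilon)
qed

text \<open>A ball in \<open>C\<close> gives a ball in the difference set \<open>E\<close>, so a
  nonzero \<open>y\<close> weakly separates \<open>C\<close> from \<open>D\<close>. It belongs to
  the barrier cone, hence to its interior, and its slices are bounded.\<close>

lemma strong_separation_property_if:
  fixes C :: "'a::{real_inner, complete_space} set"
  assumes C: "closed C" "convex C" and int: "interior C \<noteq> {}"
    and bar: "barrier_cone C \<subseteq> interior (barrier_cone C) \<union> {0}"
  shows "strong_separation_property C"
  unfolding strong_separation_property_def
proof (intro allI impI, elim conjE)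
  fix D assume D: "D \<noteq> {}" "closed D" "convex D" and disj: "C \<inter> D = {}"
  obtain c0 r where r: "r > 0" "cball c0 r \<subseteq> C" using int mem_interior_cball by blast
  have c0: "c0 \<in> C" using r by auto
  obtain d0 where d0: "d0 \<in> D" using D by blast
  define E where "E = (\<Union>d\<in>D. \<Union>c\<in>C. {d - c})"
  have "convex E" unfolding E_def using C D by (intro convex_differences)
  moreover have "0 \<notin> E" using disj by (auto simp: E_def)
  moreover have "cball (d0 - c0) r \<subseteq> E"
  proof
    fix z assume "z \<in> cball (d0 - c0) r"
    then have "d0 - z \<in> cball c0 r"
      by (simp add: dist_norm norm_minus_commute algebra_simps)
    then have "d0 - z \<in> C" using r by blast
    then show "z \<in> E" unfolding E_def using d0 by (intro UN_I[of d0] UN_I[of "d0 - z"]) auto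
  qed
  ultimately obtain y where y: "y \<noteq> 0" "\<And>x. x \<in> E \<Longrightarrow> 0 \<le> y \<bullet> x"
    using weak_separation_from_0[OF _ _ r(1), of E "d0 - c0"] by blast
  have ycd: "y \<bullet> c \<le> y \<bullet> d" if "c \<in> C" "d \<in> D" for c d
    using y(2)[of "d - c"] that by (auto simp: E_def inner_diff_right)
  then have "blinfun_inner_right y \<in> barrier_cone C"
    using d0 by (auto simp: barrier_cone_iff)
  then have f: "blinfun_inner_right y \<in> interior (barrier_cone C)"
    using bar y(1) by auto
  \<comment> \<open>The level is low enough for \<open>S\<close> to contain every point of
    \<open>C\<close> within distance \<open>1\<close> of \<open>D\<close>: moving from
    \<open>d\<close> to such a point lowers \<open>y\<close> by at most \<open>norm y\<close>, and
    \<open>y \<bullet> d \<ge> y \<bullet> c0\<close>.\<close>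
  define S where "S = {c \<in> C. y \<bullet> c0 - norm y \<le> y \<bullet> c}"
  have "S = C \<inter> {c. y \<bullet> c \<ge> y \<bullet> c0 - norm y}" by (auto simp: S_def)
  then have S: "closed S" "convex S"
    using C by (auto intro!: closed_Int convex_Int closed_halfspace_ge convex_halfspace_ge)
  have "bounded S"
    using bounded_slice[OF f, of "y \<bullet> c0 - norm y"] by (simp add: S_def)
  show "strongly_separated C D"
  proof (rule ccontr)
    assume nsep: "\<not> strongly_separated C D"
    have close: "\<exists>c\<in>C. \<exists>d\<in>D. dist c d < e" if "e > 0" for e
      using strongly_separated_if_dist_ge[OF C(2) _ D(3,1) that] nsep c0 by (auto simp: not_le[symmetric])
    define A where "A n = S \<inter> {x. infdist x D \<le> inverse (real (Suc n))}" for n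
    have "(\<Inter>n. A n) \<noteq> {}"
    proof (rule nested_closed_convex_Inter_nonempty)
      fix n
      show "closed (A n)"
        unfolding A_def using S by (intro closed_Int closed_Collect_le continuous_intros) auto
      show "convex (A n)"
        unfolding A_def using S D by (intro convex_Int convex_infdist_le)
      show "A n \<noteq> {}"
      proof -
        obtain c d where cd: "c \<in> C" "d \<in> D" "dist c d < inverse (real (Suc n))"
          using close[of "inverse (real (Suc n))"] by auto
        have "inverse (real (Suc n)) \<le> 1" by (simp add: field_simps)
        then have "dist c d \<le> 1" using cd by linarith
        then have "norm y * norm (d - c) \<le> norm y"
          by (intro mult_left_le) (auto simp: dist_norm norm_minus_commute)
        moreover have "y \<bullet> (d - c) \<le> norm y * norm (d - c)" by (rule norm_cauchy_schwarz)
        ultimately have "y \<bullet> d - norm y \<le> y \<bullet> c" by (simp add: inner_diff_right)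
        then have "c \<in> S" using ycd[OF c0 cd(2)] cd by (simp add: S_def)
        moreover have "infdist c D \<le> inverse (real (Suc n))"
          using cd by (intro infdist_le2[of d]) auto
        ultimately show ?thesis by (auto simp: A_def)
      qed
    next
      fix m n :: nat assume "m \<le> n"
      then have "inverse (real (Suc n)) \<le> inverse (real (Suc m))" by (simp add: field_simps)
      then show "A n \<subseteq> A m" unfolding A_def using order_trans by blast
    next
      show "bounded (A 0)" using \<open>bounded S\<close> by (auto simp: A_def)
    qed
    then obtain x where x: "\<And>n. x \<in> A n" by blast
    have "infdist x D \<le> 0"
    proof (rule ccontr)
      assume "\<not> infdist x D \<le> 0"
      then obtain n where "inverse (real (Suc n)) < infdist x D"
        using reals_Archimedean[of "infdist x D"] by auto
      with x[of n] show False by (simp add: A_def)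
    qed
    then have "x \<in> D"
      using in_closed_iff_infdist_zero[of D x] D infdist_nonneg[of x D] by linarith
    moreover have "x \<in> C" using x[of 0] by (simp add: A_def S_def)
    ultimately show False using disj by blast
  qed
qed

theorem theorem12:
  fixes C :: "'a::{real_inner, complete_space} set"
  assumes "\<not> bounded C" and "closed C" and "convex C"
    and "interior (barrier_cone C) \<noteq> {}
         \<or> (\<exists>r Z. r > 0 \<and> finite_dim_subspace Z \<and> C \<subseteq> ball 0 r + Z)"
  shows "strong_separation_property C \<longleftrightarrow>
         interior C \<noteq> {} \<and> barrier_cone C = interior (barrier_cone C) \<union> {0}"
proof
  assume ssp: "strong_separation_property C"
  have "C \<noteq> {}" using assms(1) by auto
  then have "barrier_cone C = interior (barrier_cone C) \<union> {0}"
    using strong_separation_property_imp_interior[OF ssp assms(3)] interior_subset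
      zero_in_barrier_cone by blast
  with strong_separation_property_imp_interior_nonempty[OF ssp assms(2,3,1)]
  show "interior C \<noteq> {} \<and> barrier_cone C = interior (barrier_cone C) \<union> {0}" by blast
next
  assume "interior C \<noteq> {} \<and> barrier_cone C = interior (barrier_cone C) \<union> {0}"
  then show "strong_separation_property C"
    using strong_separation_property_if[OF assms(2,3)] by blast
qed

end
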